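(* Let $A\in\mathbb{C}^{n\times n}$, $b_0,b_1,\dots,b_s\in\mathbb{C}^n$ with $b_s\neq 0$, let $X\in\mathbb{C}^{ns\times s}$ be any full-rank matrix whose columns form a basis of $\mathcal K_s(J,\overline b)$, let $W$, $K_X$, $c_X$ be as defined in the context, and let $b=[b_0^*,\overline b^*]^*$, $\Pi_{\rm K}=[I_n,0]\in\mathbb{C}^{n\times(n+s)}$. Then for every $m\ge1$, $$\inf_{p\in\mathcal P_{m-1}}\bigl\|\Pi_{\rm K}\bigl(\mathrm e^{K_X}-p(K_X)\bigr)c_X\bigr\|_2\;\le\; C_{\rm cr}\,\|b\|_2\,E_{m-1}\bigl(\mathrm e^z,\mathcal F(W)\bigr).$$
   Context: For a square complex matrix $M$, $\mathcal F(M)=\{z^*Mz/(z^*z): z\ne0\}$ is the field of values. $\mathcal P_{m-1}$ is the space of complex polynomials of degree at most $m-1$, and for compact $\Omega\subset\mathbb{C}$, $$E_{m-1}(f,\Omega)=\min_{p\in\mathcal P_{m-1}}\max_{\zeta\in\Omega}|f(\zeta)-p(\zeta)|.$$ $C_{\rm cr}\le 1+\sqrt2$ denotes the universal (matrix-independent) constant of the Crouzeix--Palencia theorem: $\|f(M)\|_2\le C_{\rm cr}\max_{\zeta\in\mathcal F(M)}|f(\zeta)|$ for every square complex matrix $M$ (of any size) and every $f$ analytic on a neighborhood of $\mathcal F(M)$. For a square matrix $M$ and a vector $v$, $\mathcal K_m(M,v)=\operatorname{span}\{v,Mv,\dots,M^{m-1}v\}$. Let $n,s\ge1$. $J_s(0)$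 is the $s\times s$ Jordan block with eigenvalue zero (ones on the first superdiagonal, zeros elsewhere). Set $J=J_s(0)\otimes I_n\in\mathbb{C}^{ns\times ns}$ (Kronecker product), $E=[I_n,0,\dots,0]\in\mathbb{C}^{n\times ns}$, $$W=\begin{bmatrix}A&E\\0&J\end{bmatrix}\in\mathbb{C}^{(s+1)n\times(s+1)n},\qquad \overline b=[b_1^*,\dots,b_s^*]^*\in\mathbb{C}^{ns}.$$ Since $b_s\ne0$, $\dim\mathcal K_s(J,\overline b)=s$ and this space is $J$-invariant. For $X\in\mathbb{C}^{ns\times s}$ with columns forming a basis of $\mathcal K_s(J,\overline b)$, let $N\in\mathbb{C}^{s\times s}$ be the unique matrix with $JX=XN$ and let $\gamma\in\mathbb{C}^s$ be the unique vector with $\overline b=X\gamma$. Define $$K_X=\begin{bmatrix}A&EX\\0&N\end{bmatrix},\qquad c_X=\begin{bmatrix}b_0\\\gamma\end{bmatrix}.$$ *)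

theory Defs
  imports
    "HOL-Analysis.Complex_Analysis_Basics"
    "Jordan_Normal_Form.Jordan_Normal_Form_Existence"
begin

unbundle no vec_syntax

definition norm2_vec :: "complex vec \<Rightarrow> real" where
  "norm2_vec v = sqrt (\<Sum>i<dim_vec v. (cmod (v $ i))\<^sup>2)"

definition norm2_mat :: "complex mat \<Rightarrow> real" where
  "norm2_mat M = (SUP v\<in>{v \<in> carrier_vec (dim_col M). norm2_vec v = 1}. norm2_vec (M *\<^sub>v v))"

text \<open>Here \<open>v \<bullet>c z = z\<^sup>* v\<close>: the library's product conjugates its second argument.\<close>

definition field_of_values :: "complex mat \<Rightarrow> complex set" where
  "field_of_values M =
     {((M *\<^sub>v z) \<bullet>c z) / (z \<bullet>c z) | z. z \<in> carrier_vec (dim_row M) \<and> z \<noteq> 0\<^sub>v (dim_row M)}"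

text \<open>The extrema are attained when \<open>\<Omega>\<close> is compact and nonempty and \<open>f\<close> is continuous on it.\<close>

definition best_approx :: "nat \<Rightarrow> (complex \<Rightarrow> complex) \<Rightarrow> complex set \<Rightarrow> real" where
  "best_approx d f \<Omega> = (INF p\<in>{p :: complex poly. degree p \<le> d}. SUP \<zeta>\<in>\<Omega>. cmod (f \<zeta> - poly p \<zeta>))"

definition mat_poly :: "complex poly \<Rightarrow> complex mat \<Rightarrow> complex mat" where
  "mat_poly p M = mat (dim_row M) (dim_row M)
     (\<lambda>ij. \<Sum>k\<le>degree p. coeff p k * (M ^\<^sub>m k) $$ ij)"

definition mat_exp :: "complex mat \<Rightarrow> complex mat" where
  "mat_exp M = mat (dim_row M) (dim_row M) (\<lambda>ij. \<Sum>k. (M ^\<^sub>m k) $$ ij / fact k)"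

text \<open>The matrix function \<open>f(M)\<close> for \<open>f\<close> analytic near the spectrum of \<open>M\<close>: if \<open>M = P D Q\<close> with
  \<open>Q = P\<^sup>-\<^sup>1\<close> and \<open>D\<close> the direct sum of Jordan blocks of sizes \<open>k\<close> and eigenvalues \<open>a\<close>, then
  \<open>f(M) = P f(D) Q\<close>, where \<open>f(D)\<close> is the direct sum of the upper triangular Toeplitz blocks with
  entries \<open>f\<^bsup>(j - i)\<^esup>(a) / (j - i)!\<close>. The result does not depend on the chosen decomposition.\<close>

definition jordan_block_fun :: "(complex \<Rightarrow> complex) \<Rightarrow> nat \<Rightarrow> complex \<Rightarrow> complex mat" where
  "jordan_block_fun f k a =
     mat k k (\<lambda>(i,j). if i \<le> j then (deriv ^^ (j - i)) f a / fact (j - i) else 0)"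

definition mat_fun :: "(complex \<Rightarrow> complex) \<Rightarrow> complex mat \<Rightarrow> complex mat" where
  "mat_fun f M =
     (let (n_as, P, Q) = (SOME (n_as, P, Q). 0 \<notin> fst ` set n_as \<and> similar_mat_wit M (jordan_matrix n_as) P Q)
      in P * diag_block_mat (map (\<lambda>(k,a). jordan_block_fun f k a) n_as) * Q)"

text \<open>\<open>C\<close> is a constant as in the Crouzeix--Palencia theorem.\<close>

definition crouzeix_palencia_constant :: "real \<Rightarrow> bool" where
  "crouzeix_palencia_constant C \<longleftrightarrow>
     C \<le> 1 + sqrt 2 \<and>
     (\<forall>k\<ge>1. \<forall>M \<in> carrier_mat k k. \<forall>f. f analytic_on field_of_values M \<longrightarrow>
        norm2_mat (mat_fun f M) \<le> C * (SUP \<zeta>\<in>field_of_values M. cmod (f \<zeta>)))"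

definition span_vecs :: "nat \<Rightarrow> complex vec set \<Rightarrow> complex vec set" where
  "span_vecs d S = LinearCombinations.module.span class_ring (module_vec TYPE(complex) d) S"

definition krylov :: "nat \<Rightarrow> complex mat \<Rightarrow> complex vec \<Rightarrow> complex vec set" where
  "krylov m M v = span_vecs (dim_row M) {(M ^\<^sub>m j) *\<^sub>v v | j. j < m}"

definition columns_basis :: "complex mat \<Rightarrow> complex vec set \<Rightarrow> bool" where
  "columns_basis X V \<longleftrightarrow>
     distinct (cols X) \<and>
     \<not> LinearCombinations.module.lin_dep class_ring (module_vec TYPE(complex) (dim_row X)) (set (cols X)) \<and>
     span_vecs (dim_row X) (set (cols X)) = V"

definition kronecker :: "complex mat \<Rightarrow> complex mat \<Rightarrow> complex mat" where
  "kronecker A B = mat (dim_row A * dim_row B) (dim_col A * dim_col B)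
     (\<lambda>(i,j). A $$ (i div dim_row B, j div dim_col B) * B $$ (i mod dim_row B, j mod dim_col B))"

definition J_mat :: "nat \<Rightarrow> nat \<Rightarrow> complex mat" where
  "J_mat n s = kronecker (jordan_block s 0) (1\<^sub>m n)"

definition E_mat :: "nat \<Rightarrow> nat \<Rightarrow> complex mat" where
  "E_mat n s = mat n (n * s) (\<lambda>(i,j). if i = j then 1 else 0)"

definition W_mat :: "nat \<Rightarrow> nat \<Rightarrow> complex mat \<Rightarrow> complex mat" where
  "W_mat n s A = four_block_mat A (E_mat n s) (0\<^sub>m (n * s) n) (J_mat n s)"

text \<open>The blocks \<open>b\<^sub>1, \<dots>, b\<^sub>s\<close>, each of length \<open>n\<close>, stacked on top of each other.\<close>

definition b_bar :: "nat \<Rightarrow> nat \<Rightarrow> (nat \<Rightarrow> complex vec) \<Rightarrow> complex vec" where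
  "b_bar n s b = vec (n * s) (\<lambda>i. b (i div n + 1) $ (i mod n))"

definition b_full :: "nat \<Rightarrow> nat \<Rightarrow> (nat \<Rightarrow> complex vec) \<Rightarrow> complex vec" where
  "b_full n s b = b 0 @\<^sub>v b_bar n s b"

text \<open>The matrix \<open>N\<close> and the vector \<open>\<gamma>\<close> exist uniquely when the columns of \<open>X\<close> form a basis of
  \<open>krylov s (J_mat n s) (b_bar n s b)\<close>, since this space contains \<open>b_bar n s b\<close> and is invariant
  under the nilpotent matrix \<open>J_mat n s\<close>.\<close>

definition N_mat :: "nat \<Rightarrow> nat \<Rightarrow> complex mat \<Rightarrow> complex mat" where
  "N_mat n s X = (THE N. N \<in> carrier_mat s s \<and> J_mat n s * X = X * N)"

definition gamma_vec :: "nat \<Rightarrow> nat \<Rightarrow> (nat \<Rightarrow> complex vec) \<Rightarrow> complex mat \<Rightarrow> complex vec" where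
  "gamma_vec n s b X = (THE g. g \<in> carrier_vec s \<and> b_bar n s b = X *\<^sub>v g)"

definition K_mat :: "nat \<Rightarrow> nat \<Rightarrow> complex mat \<Rightarrow> complex mat \<Rightarrow> complex mat" where
  "K_mat n s A X = four_block_mat A (E_mat n s * X) (0\<^sub>m s n) (N_mat n s X)"

definition c_vec :: "nat \<Rightarrow> nat \<Rightarrow> (nat \<Rightarrow> complex vec) \<Rightarrow> complex mat \<Rightarrow> complex vec" where
  "c_vec n s b X = b 0 @\<^sub>v gamma_vec n s b X"

definition Pi_mat :: "nat \<Rightarrow> nat \<Rightarrow> complex mat" where
  "Pi_mat n s = mat n (n + s) (\<lambda>(i,j). if i = j then 1 else 0)"

end

theory Submission
  imports Defs "HOL-Analysis.Complex_Transcendental" "Jordan_Normal_Form.DL_Rank"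
begin

text \<open>With \<open>V = diag(I, X)\<close> one has \<open>W V = V K\<^sub>X\<close>, \<open>V c\<^sub>X = b\<close>, and multiplication by \<open>V\<close> does not
  change the first \<open>n\<close> entries of a vector. Hence the first block of \<open>g(K\<^sub>X) c\<^sub>X\<close> equals that of
  \<open>g(W) b\<close> for every entire \<open>g\<close>; the Crouzeix--Palencia inequality for \<open>g = exp - p\<close> bounds the
  latter, and one takes the infimum over \<open>p\<close>. The link between the matrix function defined by the
  Jordan form and the exponential and polynomial of a matrix is the power series of \<open>g\<close>, with
  coefficients \<open>1 / k! - p\<^sub>k\<close>: power series in matrices respect intertwining relations \<open>B V = V A\<close>.\<close>

section \<open>Entire functions of matrices as power series\<close>

text \<open>The common form to which \<open>mat_exp\<close>, \<open>mat_poly\<close> and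
  \<open>mat_fun\<close> are reduced. Sums are taken entry by entry, so convergence only concerns
  complex series.\<close>

definition mat_series :: "(nat \<Rightarrow> complex) \<Rightarrow> complex mat \<Rightarrow> complex mat" where
  "mat_series c M = mat (dim_row M) (dim_row M) (\<lambda>ij. \<Sum>k. c k * (M ^\<^sub>m k) $$ ij)"

lemma mat_series_carrier [simp]: "M \<in> carrier_mat n n \<Longrightarrow> mat_series c M \<in> carrier_mat n n"
  by (simp add: mat_series_def)

lemma mat_series_dim [simp]:
  "dim_row (mat_series c M) = dim_row M" "dim_col (mat_series c M) = dim_row M"
  by (simp_all add: mat_series_def)

text \<open>Each further factor costs a sum of \<open>n\<close> products with an entry of modulus at
  most \<open>B\<close>. The bound is crude but geometric in \<open>k\<close>, which is enough
  against a power series converging everywhere.\<close>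

lemma pow_mat_entry_bound:
  fixes M :: "complex mat"
  assumes M: "M \<in> carrier_mat n n"
    and B: "\<And>i j. i < n \<Longrightarrow> j < n \<Longrightarrow> cmod (M $$ (i,j)) \<le> B"
    and "i < n" "j < n"
  shows "cmod ((M ^\<^sub>m k) $$ (i,j)) \<le> (real n * B) ^ k"
  using \<open>j < n\<close>
proof (induction k arbitrary: j)
  case 0
  then show ?case using M \<open>i < n\<close> by simp
next
  case (Suc k)
  have B0: "0 \<le> B" using B[OF \<open>i < n\<close> \<open>i < n\<close>] norm_ge_zero order_trans by blast
  have "(M ^\<^sub>m Suc k) $$ (i,j) = (\<Sum>l<n. (M ^\<^sub>m k) $$ (i,l) * M $$ (l,j))"
    using M \<open>i < n\<close> Suc.prems by (simp add: scalar_prod_def lessThan_atLeast0)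
  also have "cmod \<dots> \<le> (\<Sum>l<n. cmod ((M ^\<^sub>m k) $$ (i,l)) * cmod (M $$ (l,j)))"
    by (rule order_trans[OF norm_sum]) (simp add: norm_mult)
  also have "\<dots> \<le> (\<Sum>l<n. (real n * B) ^ k * B)"
    by (intro sum_mono mult_mono) (use Suc B B0 in auto)
  also have "\<dots> = (real n * B) ^ Suc k" by simp
  finally show ?case .
qed

lemma summable_mat_series:
  assumes c: "\<And>z::complex. summable (\<lambda>k. c k * z ^ k)"
    and M: "M \<in> carrier_mat n n" and ij: "i < n" "j < n"
  shows "summable (\<lambda>k. c k * (M ^\<^sub>m k) $$ (i,j))"
proof -
  have "finite ((\<lambda>(i,j). cmod (M $$ (i,j))) ` ({..<n} \<times> {..<n}))" by simp
  then obtain B where "\<forall>x \<in> (\<lambda>(i,j). cmod (M $$ (i,j))) ` ({..<n} \<times> {..<n}). x \<le> B"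
    using bdd_above_finite unfolding bdd_above_def by blast
  then have B: "cmod (M $$ (i,j)) \<le> B" if "i < n" "j < n" for i j using that by auto
  have B0: "0 \<le> B" using B[OF ij] norm_ge_zero order_trans by blast
  let ?R = "real n * B"
  \<comment> \<open>Convergence at the larger point \<open>?R + 1\<close> forces absolute
    convergence at \<open>?R\<close>.\<close>
  have "summable (\<lambda>k. norm (c k * complex_of_real ?R ^ k))"
    by (rule powser_insidea[OF c[of "of_real (?R + 1)"]], use B0 in \<open>simp only: norm_of_real\<close>) simp
  then show ?thesis
  proof (rule summable_comparison_test'[where N = 0])
    fix k
    have "cmod ((M ^\<^sub>m k) $$ (i,j)) \<le> ?R ^ k"
      by (rule pow_mat_entry_bound[OF M B ij])
    then show "cmod (c k * (M ^\<^sub>m k) $$ (i,j)) \<le> norm (c k * complex_of_real ?R ^ k)"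
      using B0 by (simp add: norm_mult norm_power mult_left_mono)
  qed
qed

text \<open>\<open>V\<close> may be rectangular, as it is for the embedding of the small problem
  into the large one. The case \<open>V = A = B\<close> says that a matrix commutes with its
  powers.\<close>

lemma pow_mat_intertwine:
  fixes A B V :: "complex mat"
  assumes A: "A \<in> carrier_mat n n" and B: "B \<in> carrier_mat m m" and V: "V \<in> carrier_mat m n"
    and BV: "B * V = V * A"
  shows "B ^\<^sub>m k * V = V * A ^\<^sub>m k"
proof (induction k)
  case 0
  then show ?case using A B V by simp
next
  case (Suc k)
  have "B ^\<^sub>m Suc k * V = B ^\<^sub>m k * (B * V)" using A B V by (simp add: assoc_mult_mat[of _ m m _ m _ n])
  also have "\<dots> = (B ^\<^sub>m k * V) * A" using A B V BV by (simp add: assoc_mult_mat[of _ m m _ n _ n])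
  also have "\<dots> = V * A ^\<^sub>m Suc k" using A B V Suc by (simp add: assoc_mult_mat[of _ m n _ n _ n])
  finally show ?case .
qed

text \<open>The relation holds for every power; multiplication by \<open>V\<close> is a finite sum
  in each entry and so may be exchanged with the series.\<close>

lemma mat_series_intertwine:
  assumes c: "\<And>z::complex. summable (\<lambda>k. c k * z ^ k)"
    and A: "A \<in> carrier_mat n n" and B: "B \<in> carrier_mat m m" and V: "V \<in> carrier_mat m n"
    and BV: "B * V = V * A"
  shows "mat_series c B * V = V * mat_series c A"
proof (rule eq_matI)
  fix i j assume "i < dim_row (V * mat_series c A)" "j < dim_col (V * mat_series c A)"
  then have i: "i < m" and j: "j < n" using A V by (auto simp: mat_series_def)
  have "(mat_series c B * V) $$ (i,j) = (\<Sum>l<m. (\<Sum>k. c k * (B ^\<^sub>m k) $$ (i,l)) * V $$ (l,j))"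
    using B V i j by (simp add: scalar_prod_def lessThan_atLeast0 mat_series_def)
  also have "\<dots> = (\<Sum>l<m. (\<Sum>k. c k * (B ^\<^sub>m k) $$ (i,l) * V $$ (l,j)))"
    by (intro sum.cong refl suminf_mult2 summable_mat_series[OF c B]) (use i in auto)
  also have "\<dots> = (\<Sum>k. \<Sum>l<m. c k * (B ^\<^sub>m k) $$ (i,l) * V $$ (l,j))"
    by (intro suminf_sum[symmetric] summable_mult2 summable_mat_series[OF c B]) (use i in auto)
  also have "\<dots> = (\<Sum>k. c k * (B ^\<^sub>m k * V) $$ (i,j))"
    using B V i j by (simp add: scalar_prod_def lessThan_atLeast0 sum_distrib_left mult.assoc)
  also have "\<dots> = (\<Sum>k. c k * (V * A ^\<^sub>m k) $$ (i,j))"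
    by (simp add: pow_mat_intertwine[OF A B V BV])
  also have "\<dots> = (\<Sum>k. \<Sum>l<n. V $$ (i,l) * (c k * (A ^\<^sub>m k) $$ (l,j)))"
    using A V i j by (simp add: scalar_prod_def lessThan_atLeast0 sum_distrib_left mult_ac)
  also have "\<dots> = (\<Sum>l<n. (\<Sum>k. V $$ (i,l) * (c k * (A ^\<^sub>m k) $$ (l,j))))"
    by (intro suminf_sum summable_mult summable_mat_series[OF c A]) (use j in auto)
  also have "\<dots> = (\<Sum>l<n. V $$ (i,l) * (\<Sum>k. c k * (A ^\<^sub>m k) $$ (l,j)))"
    by (intro sum.cong refl suminf_mult summable_mat_series[OF c A]) (use j in auto)
  also have "\<dots> = (V * mat_series c A) $$ (i,j)"
    using A V i j by (simp add: scalar_prod_def lessThan_atLeast0 mat_series_def)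
  finally show "(mat_series c B * V) $$ (i,j) = (V * mat_series c A) $$ (i,j)" .
qed (use A B V in \<open>auto simp: mat_series_def\<close>)

section \<open>Power series on Jordan matrices\<close>

text \<open>The factor is \<open>(k + d)! / k!\<close>, produced by differentiating
  \<open>z ^ (k + d)\<close> exactly \<open>d\<close> times. After division by \<open>fact d\<close>
  the binomial left over is the one in the powers of a Jordan block.\<close>

lemma diffs_funpow: "(diffs ^^ d) c k = fact d * of_nat ((k + d) choose d) * (c (k + d) :: complex)"
proof (induction d arbitrary: k)
  case (Suc d)
  have "of_nat (Suc k) * (fact d * of_nat ((Suc k + d) choose d)) =
      (fact (Suc d) * of_nat ((k + Suc d) choose Suc d) :: complex)"
  proof -
    have "Suc k * (fact d * ((Suc k + d) choose d)) = (fact (Suc d) * ((k + Suc d) choose Suc d) :: nat)"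
    proof -
      \<comment> \<open>Both sides equal \<open>(k + d + 1) * ((k + d) choose d)\<close>.\<close>
      have "Suc k * ((Suc k + d) choose d) = Suc d * ((k + Suc d) choose Suc d)"
        using binomial_absorb_comp[of "Suc k + d" d] binomial_absorption[of d "k + Suc d"]
        by (simp add: algebra_simps)
      then show ?thesis by (simp add: algebra_simps)
    qed
    then show ?thesis by (metis of_nat_fact of_nat_mult)
  qed
  then show ?case using Suc by (simp add: diffs_def del: of_nat_Suc fact_Suc binomial_Suc_Suc add: mult.assoc)
qed simp

text \<open>Termwise differentiation, repeated. The induction needs the expansion at all
  \<open>z\<close> at once, since \<open>deriv\<close> acts on the whole function.\<close>

lemma higher_deriv_entire:
  assumes "\<And>z::complex. (\<lambda>k. c k * z ^ k) sums f z"
  shows "(\<lambda>k. (diffs ^^ d) c k * z ^ k) sums (deriv ^^ d) f z"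
proof (induction d arbitrary: z)
  case 0
  then show ?case using assms by simp
next
  case (Suc d)
  let ?c = "(diffs ^^ d) c" and ?f = "(deriv ^^ d) f"
  have s: "summable (\<lambda>k. ?c k * w ^ k)" for w using Suc sums_summable by blast
  have f: "?f = (\<lambda>w. \<Sum>k. ?c k * w ^ k)" using Suc by (auto simp: sums_iff)
  have "((\<lambda>w. \<Sum>k. ?c k * w ^ k) has_field_derivative (\<Sum>k. diffs ?c k * z ^ k)) (at z)"
    by (rule termdiffs_strong_converges_everywhere) (rule s)
  then have "deriv ?f z = (\<Sum>k. diffs ?c k * z ^ k)" unfolding f by (rule DERIV_imp_deriv)
  moreover have "summable (\<lambda>k. diffs ?c k * z ^ k)" by (rule termdiff_converges_all) (rule s)
  ultimately show ?case by (simp add: sums_iff)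
qed

text \<open>On the superdiagonal \<open>d = j - i\<close> the \<open>r\<close>-th power has entry
  \<open>(r choose d) * a ^ (r - d)\<close>. Weighted by \<open>c r\<close> and summed, these give
  the Taylor coefficient of \<open>f\<close> at \<open>a\<close>.\<close>

lemma mat_series_jordan_block:
  assumes f: "\<And>z::complex. (\<lambda>k. c k * z ^ k) sums f z"
  shows "mat_series c (jordan_block k a) = jordan_block_fun f k a"
proof (rule eq_matI)
  fix i j assume "i < dim_row (jordan_block_fun f k a)" "j < dim_col (jordan_block_fun f k a)"
  then have ij: "i < k" "j < k" by (auto simp: jordan_block_fun_def)
  show "mat_series c (jordan_block k a) $$ (i,j) = jordan_block_fun f k a $$ (i,j)"
  proof (cases "i \<le> j")
    case True
    define d where "d = j - i"
    let ?t = "\<lambda>r. c r * (of_nat (r choose d) * a ^ (r - d))"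
    have "(\<lambda>r. (diffs ^^ d) c r * a ^ r / fact d) sums ((deriv ^^ d) f a / fact d)"
      by (intro sums_divide higher_deriv_entire f)
    also have "(\<lambda>r. (diffs ^^ d) c r * a ^ r / fact d) = (\<lambda>r. ?t (r + d))"
      by (simp add: diffs_funpow mult_ac)
    finally have "?t sums ((deriv ^^ d) f a / fact d + (\<Sum>r<d. ?t r))"
      by (rule sums_iff_shift[of ?t d, THEN iffD1])
    \<comment> \<open>The terms lost in the shift by \<open>d\<close> vanish because
      \<open>r choose d = 0\<close> for \<open>r < d\<close>.\<close>
    moreover have "(\<Sum>r<d. ?t r) = 0" by (intro sum.neutral) simp
    ultimately have "?t sums ((deriv ^^ d) f a / fact d)" by simp
    \<comment> \<open>For \<open>i \<le> j\<close> the truncated difference \<open>r + i - j\<close>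
      agrees with \<open>r - (j - i)\<close>.\<close>
    moreover have "(\<lambda>r. c r * (of_nat (r choose (j - i)) * a ^ (r + i - j))) = ?t"
      using True by (simp add: d_def)
    ultimately have "(\<Sum>r. c r * (of_nat (r choose (j - i)) * a ^ (r + i - j))) = (deriv ^^ d) f a / fact d"
      by (simp only: sums_iff)
    then show ?thesis
      using ij True by (simp add: mat_series_def jordan_block_fun_def jordan_block_pow d_def)
  qed (use ij in \<open>simp add: mat_series_def jordan_block_fun_def jordan_block_pow\<close>)
qed (auto simp: mat_series_def jordan_block_fun_def)

text \<open>Powers of a block diagonal matrix are formed block by block, and the series of the zero
  blocks is zero.\<close>

lemma mat_series_diag_block_mat:
  assumes "Ball (set Ms) square_mat"
  shows "mat_series c (diag_block_mat Ms) = diag_block_mat (map (mat_series c) Ms)"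
  using assms
proof (induction Ms)
  case Nil
  then show ?case by (intro eq_matI) (auto simp: mat_series_def)
next
  case (Cons M Ms)
  let ?D = "diag_block_mat Ms"
  have sqM: "dim_row M = dim_col M" using Cons.prems by simp
  have sqD: "dim_row ?D = dim_col ?D" using diag_block_mat_square[of Ms] Cons.prems by simp
  have "M \<in> carrier_mat (dim_row M) (dim_row M)" "?D \<in> carrier_mat (dim_row ?D) (dim_row ?D)"
    using sqM sqD by auto
  note dims = this[THEN pow_mat_dim_square(1)] this[THEN pow_mat_dim_square(2)]
  have pow: "diag_block_mat (M # Ms) ^\<^sub>m k =
      four_block_mat (M ^\<^sub>m k) (0\<^sub>m (dim_row M) (dim_col ?D)) (0\<^sub>m (dim_row ?D) (dim_col M)) (?D ^\<^sub>m k)" for k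
  proof -
    have D: "diag_block_mat (map (\<lambda>A. A ^\<^sub>m k) Ms) = ?D ^\<^sub>m k"
      using Cons.prems by (intro diag_block_pow_mat[symmetric]) simp
    show ?thesis
      unfolding diag_block_pow_mat[OF Cons.prems]
      by (simp only: list.map diag_block_mat.simps Let_def D dims flip: sqM sqD)
  qed
  have "mat_series c (diag_block_mat (M # Ms)) =
      four_block_mat (mat_series c M) (0\<^sub>m (dim_row M) (dim_col ?D)) (0\<^sub>m (dim_row ?D) (dim_col M)) (mat_series c ?D)"
  proof (rule eq_matI, goal_cases)
    case (1 i j)
    then show ?case
      unfolding mat_series_def pow
      by (auto simp: Let_def dims sqM[symmetric] sqD[symmetric] simp del: pow_mat_dim)
  qed (auto simp: mat_series_def Let_def)
  moreover have "diag_block_mat (map (mat_series c) Ms) = mat_series c ?D" using Cons by simp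
  ultimately show ?case using sqM sqD by (simp only: list.map diag_block_mat.simps Let_def mat_series_dim)
qed

text \<open>The intertwining property with \<open>V = P\<close> transports the identity from the Jordan form to
  \<open>M\<close>, whichever decomposition the choice operator picks.\<close>

lemma mat_fun_eq_mat_series:
  assumes M: "M \<in> carrier_mat n n" and f: "\<And>z::complex. (\<lambda>k. c k * z ^ k) sums f z"
  shows "mat_fun f M = mat_series c M"
proof -
  let ?P = "\<lambda>(n_as, P, Q). 0 \<notin> fst ` set n_as \<and> similar_mat_wit M (jordan_matrix n_as) P Q"
  \<comment> \<open>The characteristic polynomial splits over the complex numbers, so the choice in
    \<open>mat_fun\<close> ranges over a nonempty set.\<close>
  have "\<exists>n_as. jordan_nf M n_as" using char_poly_factorized[OF M] jordan_nf_exists[OF M] by blast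
  then have "\<exists>x. ?P x" by (auto simp: jordan_nf_def similar_mat_def)
  then have "?P (SOME x. ?P x)" by (rule someI_ex)
  then obtain n_as P Q where eq: "(SOME x. ?P x) = (n_as, P, Q)"
    and wit: "similar_mat_wit M (jordan_matrix n_as) P Q" by (cases "SOME x. ?P x") auto
  let ?J = "jordan_matrix n_as"
  note w = similar_mat_witD2[OF M wit]
  have "mat_series c ?J = diag_block_mat (map (\<lambda>(k,a). jordan_block_fun f k a) n_as)"
    unfolding jordan_matrix_def
    by (subst mat_series_diag_block_mat)
      (auto simp: mat_series_jordan_block[OF f] intro!: arg_cong[of _ _ diag_block_mat])
  then have "mat_fun f M = P * mat_series c ?J * Q"
    by (simp only: mat_fun_def eq Let_def prod.case)
  also have "P * mat_series c ?J = mat_series c M * P"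
  proof (rule mat_series_intertwine[OF sums_summable[OF f] w(5) w(4) w(6), symmetric])
    have "P * ?J * Q * P = P * ?J * (Q * P)"
      by (rule assoc_mult_mat[OF mult_carrier_mat[OF w(6) w(5)] w(7) w(6)])
    then show "M * P = P * ?J"
      using w(2,3) right_mult_one_mat[OF mult_carrier_mat[OF w(6) w(5)]] by simp
  qed
  also have "mat_series c M * P * Q = mat_series c M"
    using assoc_mult_mat[OF mat_series_carrier[OF M] w(6) w(7)] w(1)
      right_mult_one_mat[OF mat_series_carrier[OF M]] by simp
  finally show ?thesis .
qed

section \<open>The exponential minus a polynomial\<close>

lemma sums_exp_minus_poly: "(\<lambda>k. (1 / fact k - coeff p k) * z ^ k) sums (exp z - poly p z)"
  for z :: complex
proof -
  have "(\<lambda>k. z ^ k /\<^sub>R fact k - coeff p k * z ^ k) sums (exp z - (\<Sum>k\<le>degree p. coeff p k * z ^ k))"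
    by (intro sums_diff exp_converges sums_finite) (auto simp: coeff_eq_0)
  then show ?thesis by (simp add: poly_altdef scaleR_conv_of_real field_simps)
qed

lemma mat_exp_minus_mat_poly:
  assumes M: "M \<in> carrier_mat n n"
  shows "mat_exp M - mat_poly p M = mat_series (\<lambda>k. 1 / fact k - coeff p k) M"
proof (rule eq_matI, goal_cases)
  case (1 i j)
  then have ij: "i < n" "j < n" using M by (auto simp: mat_series_def)
  \<comment> \<open>The difference of two series may be split only if both converge;
    \<open>p = 0\<close> yields the exponential series alone.\<close>
  have "summable (\<lambda>k. 1 / fact k * z ^ k)" for z :: complex
    using sums_summable[OF sums_exp_minus_poly[of 0]] by simp
  from summable_mat_series[OF this M ij]
  have "summable (\<lambda>k. (M ^\<^sub>m k) $$ (i,j) / fact k)" by simp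
  then have "(\<lambda>k. (M ^\<^sub>m k) $$ (i,j) / fact k - coeff p k * (M ^\<^sub>m k) $$ (i,j)) sums
     ((\<Sum>k. (M ^\<^sub>m k) $$ (i,j) / fact k) - (\<Sum>k\<le>degree p. coeff p k * (M ^\<^sub>m k) $$ (i,j)))"
    by (intro sums_diff summable_sums sums_finite) (auto simp: coeff_eq_0)
  then show ?case using M ij
    by (simp add: mat_exp_def mat_poly_def mat_series_def sums_iff left_diff_distrib)
qed (auto simp: mat_series_def mat_exp_def mat_poly_def)

section \<open>Euclidean and spectral norms\<close>

lemma norm2_vec_L2_set: "norm2_vec v = L2_set (\<lambda>i. cmod (v $ i)) {..<dim_vec v}"
  by (simp add: norm2_vec_def L2_set_def)

lemma norm2_vec_nonneg [simp]: "0 \<le> norm2_vec v"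
  by (simp add: norm2_vec_L2_set)

lemma norm2_vec_smult: "norm2_vec (a \<cdot>\<^sub>v v) = cmod a * norm2_vec v"
  unfolding norm2_vec_def by (simp add: norm_mult power_mult_distrib real_sqrt_mult flip: sum_distrib_left)

lemma norm2_vec_eq_0_iff: "norm2_vec v = 0 \<longleftrightarrow> v = 0\<^sub>v (dim_vec v)"
  by (auto simp: norm2_vec_L2_set L2_set_eq_0_iff vec_eq_iff)

lemma norm2_vec_unit_vec: "i < n \<Longrightarrow> norm2_vec (unit_vec n i) = 1"
proof -
  assume "i < n"
  then have "(\<Sum>j<n. (cmod (unit_vec n i $ j))\<^sup>2) = (\<Sum>j<n. if j = i then 1 else 0)"
    by (intro sum.cong) auto
  with \<open>i < n\<close> show ?thesis by (simp add: norm2_vec_def)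
qed

text \<open>A real \<open>SUP\<close> bounds its set only if that set is bounded. Components of a
  unit vector have modulus at most 1, so the sum of the moduli of all entries is a bound.\<close>

lemma bdd_above_norm2_mat:
  "bdd_above ((\<lambda>v. norm2_vec (M *\<^sub>v v)) ` {v \<in> carrier_vec (dim_col M). norm2_vec v = 1})"
proof (rule bdd_aboveI2, clarsimp)
  fix v :: "complex vec" assume v: "v \<in> carrier_vec (dim_col M)" and 1: "norm2_vec v = 1"
  have le1: "cmod (v $ j) \<le> 1" if "j < dim_col M" for j
    using member_le_L2_set[of "{..<dim_vec v}" j "\<lambda>i. cmod (v $ i)"] 1 v that
    by (simp add: norm2_vec_L2_set)
  have "norm2_vec (M *\<^sub>v v) \<le> (\<Sum>i<dim_row M. cmod ((M *\<^sub>v v) $ i))"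
    unfolding norm2_vec_L2_set by (rule order_trans[OF L2_set_le_sum]) auto
  also have "\<dots> \<le> (\<Sum>i<dim_row M. \<Sum>j<dim_col M. cmod (M $$ (i,j)))"
  proof (rule sum_mono)
    fix i assume "i \<in> {..<dim_row M}"
    then have "(M *\<^sub>v v) $ i = (\<Sum>j<dim_col M. M $$ (i,j) * v $ j)"
      using v by (simp add: scalar_prod_def lessThan_atLeast0)
    also have "cmod \<dots> \<le> (\<Sum>j<dim_col M. cmod (M $$ (i,j)))"
      by (rule order_trans[OF norm_sum], rule sum_mono) (use le1 in \<open>auto simp: norm_mult mult_left_le\<close>)
    finally show "cmod ((M *\<^sub>v v) $ i) \<le> (\<Sum>j<dim_col M. cmod (M $$ (i,j)))" .
  qed
  finally show "norm2_vec (M *\<^sub>v v) \<le> (\<Sum>i<dim_row M. \<Sum>j<dim_col M. cmod (M $$ (i,j)))" .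
qed

text \<open>Scaling \<open>v\<close> to length 1 reduces to the defining supremum; a zero vector
  cannot be scaled and is treated separately.\<close>

lemma norm2_mult_mat_vec_le:
  assumes v: "v \<in> carrier_vec (dim_col M)"
  shows "norm2_vec (M *\<^sub>v v) \<le> norm2_mat M * norm2_vec v"
proof (cases "norm2_vec v = 0")
  case True
  then have "v = 0\<^sub>v (dim_col M)" using v by (simp add: norm2_vec_eq_0_iff)
  then have "M *\<^sub>v v = 0\<^sub>v (dim_row M)" by (auto intro!: eq_vecI simp: scalar_prod_def)
  then show ?thesis using True norm2_vec_eq_0_iff[of "M *\<^sub>v v"] by simp
next
  case False
  then have pos: "0 < norm2_vec v" by (simp add: less_le)
  let ?a = "complex_of_real (1 / norm2_vec v)"
  have "norm2_vec (M *\<^sub>v (?a \<cdot>\<^sub>v v)) \<le> norm2_mat M"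
    unfolding norm2_mat_def
    by (rule cSUP_upper[OF _ bdd_above_norm2_mat]) (use v pos in \<open>simp add: norm2_vec_smult norm_divide\<close>)
  also have "M *\<^sub>v (?a \<cdot>\<^sub>v v) = ?a \<cdot>\<^sub>v (M *\<^sub>v v)"
    using v by (intro mult_mat_vec[of _ "dim_row M" "dim_col M"]) auto
  finally show ?thesis using pos by (simp add: norm2_vec_smult norm_divide field_simps)
qed

text \<open>A column guarantees a unit vector, so that the supremum is over a nonempty set.\<close>

lemma norm2_mat_nonneg:
  assumes "0 < dim_col M"
  shows "0 \<le> norm2_mat M"
proof -
  have "norm2_vec (M *\<^sub>v unit_vec (dim_col M) 0) \<le> norm2_mat M * norm2_vec (unit_vec (dim_col M) 0)"
    by (rule norm2_mult_mat_vec_le) simp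
  then have "norm2_vec (M *\<^sub>v unit_vec (dim_col M) 0) \<le> norm2_mat M"
    by (simp add: norm2_vec_unit_vec[OF assms])
  then show ?thesis by (rule order_trans[OF norm2_vec_nonneg])
qed


section \<open>The Krylov space of \<open>J\<close>\<close>

text \<open>Turns spans into ranges of matrices, so that the Krylov argument becomes one about
  matrix factorisations.\<close>

lemma span_vecs_set:
  assumes ws: "set ws \<subseteq> carrier_vec d"
  shows "span_vecs d (set ws) = {mat_of_cols d ws *\<^sub>v x | x. x \<in> carrier_vec (length ws)}"
proof -
  interpret vec_space "TYPE(complex)" d .
  have dim: "\<forall>w\<in>set ws. dim_vec w = d" using ws by auto
  have "span_vecs d (set ws) = span_list ws"
    unfolding span_vecs_def span_list_as_span[OF ws] ..
  also have "\<dots> = {mat_of_cols d ws *\<^sub>v x | x. x \<in> carrier_vec (length ws)}" (is "_ = ?R")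
  proof (intro equalityI subsetI)
    fix v assume "v \<in> span_list ws"
    then obtain a where "v = lincomb_list a ws" by (rule in_span_listE)
    then show "v \<in> ?R" using lincomb_list_as_mat_mult[OF dim] by auto
  next
    fix v assume "v \<in> ?R"
    then obtain x where x: "x \<in> carrier_vec (length ws)" "v = mat_of_cols d ws *\<^sub>v x" by auto
    have "vec (length ws) (\<lambda>i. x $ i) = x" using x(1) by auto
    then have "v = lincomb_list (\<lambda>i. x $ i) ws" using lincomb_list_as_mat_mult[OF dim] x(2) by simp
    then show "v \<in> span_list ws" by (intro in_span_listI) auto
  qed
  finally show ?thesis .
qed

lemma zero_mat_mult_vec: "v \<in> carrier_vec t \<Longrightarrow> 0\<^sub>m d t *\<^sub>v v = (0\<^sub>v d :: complex vec)"
  by (intro eq_vecI) auto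

lemma mult_unit_vec_eq_col:
  fixes A :: "complex mat"
  assumes "A \<in> carrier_mat d t" "j < t"
  shows "A *\<^sub>v unit_vec t j = col A j"
  using assms by (intro eq_vecI) (auto simp: scalar_prod_right_unit[of _ t])

text \<open>The chosen coefficient vectors of the columns of \<open>A\<close> are the columns of
  \<open>Y\<close>.\<close>

lemma mat_factor:
  fixes A B :: "complex mat"
  assumes B: "B \<in> carrier_mat d r" and A: "A \<in> carrier_mat d t"
    and col: "\<And>j. j < t \<Longrightarrow> \<exists>x \<in> carrier_vec r. col A j = B *\<^sub>v x"
  obtains Y where "Y \<in> carrier_mat r t" "A = B * Y"
proof -
  obtain y where y: "\<And>j. j < t \<Longrightarrow> y j \<in> carrier_vec r \<and> col A j = B *\<^sub>v y j"
    using col by metis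
  define Y where "Y = mat_of_cols r (map y [0..<t])"
  have Y: "Y \<in> carrier_mat r t" by (auto simp: Y_def intro!: carrier_matI)
  have "A = B * Y"
  proof (rule mat_col_eqI)
    fix j assume "j < dim_col (B * Y)"
    then have j: "j < t" using Y by simp
    then have "col Y j = y j" using y by (simp add: Y_def col_mat_of_cols)
    then show "col A j = col (B * Y) j" using j y col_mult2[OF B Y j] by simp
  qed (use A B Y in auto)
  with Y show thesis by (rule that)
qed

lemma columns_basis_inj:
  assumes X: "X \<in> carrier_mat d r" and basis: "columns_basis X V"
    and x: "x \<in> carrier_vec r" and y: "y \<in> carrier_vec r" and eq: "X *\<^sub>v x = X *\<^sub>v y"
  shows "x = y"
proof (rule ccontr)
  assume "x \<noteq> y"
  interpret vec_space "TYPE(complex)" d .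
  have "X *\<^sub>v (x - y) = X *\<^sub>v x - X *\<^sub>v y" using X x y by (rule mult_minus_distrib_mat_vec)
  also have "\<dots> = 0\<^sub>v d" unfolding eq using X y by simp
  finally have "X *\<^sub>v (x - y) = 0\<^sub>v d" .
  moreover have "x - y \<noteq> 0\<^sub>v r"
  proof
    assume "x - y = 0\<^sub>v r"
    then have "(x - y) $ i = 0" if "i < r" for i using that by simp
    then have "x = y" using x y by (intro eq_vecI) auto
    with \<open>x \<noteq> y\<close> show False ..
  qed
  \<comment> \<open>Dependence concerns the set of columns; distinctness from
    \<open>columns_basis\<close> turns the nonzero kernel vector \<open>x - y\<close> into such a
    dependence.\<close>
  ultimately have "lin_dep (set (cols X))"
    using X x y basis unfolding columns_basis_def by (intro lin_depI) auto
  then show False using basis X unfolding columns_basis_def by auto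
qed

lemma columns_basis_inj_mat:
  assumes X: "X \<in> carrier_mat d r" and basis: "columns_basis X V"
    and A: "A \<in> carrier_mat r t" and B: "B \<in> carrier_mat r t" and eq: "X * A = X * B"
  shows "A = B"
proof (rule mat_col_eqI)
  fix j assume "j < dim_col B"
  then have j: "j < t" using B by simp
  have "X *\<^sub>v col A j = X *\<^sub>v col B j"
    using col_mult2[OF X A j] col_mult2[OF X B j] eq by simp
  then show "col A j = col B j"
    using A B j by (intro columns_basis_inj[OF X basis, of "col A j"]) simp_all
qed (use A B in auto)

lemma columns_basis_range:
  assumes X: "X \<in> carrier_mat d r" and basis: "columns_basis X V"
  shows "V = {X *\<^sub>v x | x. x \<in> carrier_vec r}"
proof -
  have "set (cols X) \<subseteq> carrier_vec d" using cols_dim[of X] X by simp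
  moreover have "mat_of_cols d (cols X) = X" "length (cols X) = r" using X by auto
  moreover have "V = span_vecs d (set (cols X))" using basis X by (auto simp: columns_basis_def)
  ultimately show ?thesis using span_vecs_set[of "cols X" d] by simp
qed

section \<open>Krylov matrices\<close>

definition krylov_mat :: "nat \<Rightarrow> complex mat \<Rightarrow> complex vec \<Rightarrow> complex mat" where
  "krylov_mat m M v = mat_of_cols (dim_row M) (map (\<lambda>j. (M ^\<^sub>m j) *\<^sub>v v) [0..<m])"

lemma krylov_mat_carrier [simp]: "M \<in> carrier_mat d d \<Longrightarrow> krylov_mat m M v \<in> carrier_mat d m"
  by (auto simp: krylov_mat_def intro!: carrier_matI)

lemma col_krylov_mat:
  "M \<in> carrier_mat d d \<Longrightarrow> v \<in> carrier_vec d \<Longrightarrow> j < m \<Longrightarrow> col (krylov_mat m M v) j = (M ^\<^sub>m j) *\<^sub>v v"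
  by (simp add: krylov_mat_def col_mat_of_cols mult_mat_vec_carrier[of _ d d])

lemma krylov_range:
  assumes M: "M \<in> carrier_mat d d" and v: "v \<in> carrier_vec d"
  shows "krylov m M v = {krylov_mat m M v *\<^sub>v x | x. x \<in> carrier_vec m}"
proof -
  let ?ws = "map (\<lambda>j. (M ^\<^sub>m j) *\<^sub>v v) [0..<m]"
  have "set ?ws = {(M ^\<^sub>m j) *\<^sub>v v | j. j < m}" by auto
  moreover have "set ?ws \<subseteq> carrier_vec d" using M v by (auto simp: mult_mat_vec_carrier[of _ d d])
  ultimately show ?thesis
    using span_vecs_set[of ?ws d] M by (simp add: krylov_def krylov_mat_def)
qed

text \<open>\<open>M\<close> sends each Krylov vector to the next and the last one to zero, so the
  columns of \<open>S\<close> are shifted unit vectors followed by a zero column.\<close>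

lemma krylov_mat_shift:
  assumes M: "M \<in> carrier_mat d d" and v: "v \<in> carrier_vec d" and nil: "(M ^\<^sub>m m) *\<^sub>v v = 0\<^sub>v d"
  obtains S where "S \<in> carrier_mat m m" "M * krylov_mat m M v = krylov_mat m M v * S"
proof (rule mat_factor[of "krylov_mat m M v" d m "M * krylov_mat m M v" m])
  fix j assume j: "j < m"
  let ?G = "krylov_mat m M v"
  have G: "?G \<in> carrier_mat d m" using M by simp
  have "col (M * ?G) j = M *\<^sub>v (M ^\<^sub>m j *\<^sub>v v)"
    using col_mult2[OF M G j] col_krylov_mat[OF M v j] by simp
  also have "\<dots> = (M * M ^\<^sub>m j) *\<^sub>v v" using M v by (simp add: assoc_mult_mat_vec[of _ d d _ d])
  also have "M * M ^\<^sub>m j = M ^\<^sub>m Suc j" using pow_mat_intertwine[OF M M M refl, of j] by simp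
  finally have col: "col (M * ?G) j = (M ^\<^sub>m Suc j) *\<^sub>v v" .
  show "\<exists>x\<in>carrier_vec m. col (M * ?G) j = ?G *\<^sub>v x"
  proof (cases "Suc j < m")
    case True
    have "col (M * ?G) j = ?G *\<^sub>v unit_vec m (Suc j)"
      using mult_unit_vec_eq_col[OF G True] col_krylov_mat[OF M v True] col by simp
    then show ?thesis by auto
  next
    case False
    then have "Suc j = m" using j by simp
    moreover have "?G *\<^sub>v 0\<^sub>v m = 0\<^sub>v d" using G by (intro eq_vecI) (auto simp: scalar_prod_def)
    ultimately have "col (M * ?G) j = ?G *\<^sub>v 0\<^sub>v m" using col nil by simp
    then show ?thesis by auto
  qed
qed (use M in auto)

section \<open>The nilpotent block shift\<close>

lemma J_mat_carrier [simp]: "J_mat n s \<in> carrier_mat (n * s) (n * s)"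
  by (simp add: J_mat_def kronecker_def mult.commute)

lemma J_mat_dim [simp]: "dim_row (J_mat n s) = n * s" "dim_col (J_mat n s) = n * s"
  using J_mat_carrier[of n s] by (simp_all only: carrier_mat_def mem_Collect_eq)

text \<open>\<open>i div n\<close> is the block and \<open>i mod n\<close> the position inside it.
  Moving to the same position of the next block adds \<open>n\<close> to the index.\<close>

lemma J_mat_entry:
  assumes "i < n * s" "j < n * s"
  shows "J_mat n s $$ (i,j) = (if j = i + n then 1 else 0)"
proof -
  have n: "0 < n" using assms by (cases n) auto
  have d: "i div n < s" "j div n < s" using assms by (auto simp: less_mult_imp_div_less mult.commute)
  have "(j div n = Suc (i div n) \<and> i mod n = j mod n) \<longleftrightarrow> j = i + n"
  proof
    assume "j div n = Suc (i div n) \<and> i mod n = j mod n"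
    then have "j = Suc (i div n) * n + i mod n" using div_mult_mod_eq[of j n] by simp
    also have "\<dots> = i + n" using div_mult_mod_eq[of i n] by simp
    finally show "j = i + n" .
  qed (use n in simp)
  then show ?thesis using assms d n
    by (auto simp: J_mat_def kronecker_def jordan_block_def mult.commute)
qed

lemma J_mat_pow_entry:
  assumes "i < n * s" "j < n * s"
  shows "(J_mat n s ^\<^sub>m k) $$ (i,j) = (if j = i + k * n then 1 else 0)"
  using assms(2)
proof (induction k arbitrary: j)
  case 0
  then show ?case using assms(1) J_mat_carrier[of n s] by auto
next
  case (Suc k)
  have "(J_mat n s ^\<^sub>m Suc k) $$ (i,j) = (\<Sum>l<n * s. (J_mat n s ^\<^sub>m k) $$ (i,l) * J_mat n s $$ (l,j))"
    using J_mat_carrier[of n s] assms(1) Suc.prems by (simp add: scalar_prod_def lessThan_atLeast0)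
  \<comment> \<open>If \<open>i + k * n\<close> lies outside the range, no term survives, and
    \<open>j = i + Suc k * n\<close> is impossible too.\<close>
  also have "\<dots> = (\<Sum>l<n * s. if l = i + k * n then (if j = l + n then 1 else 0) else 0)"
    by (intro sum.cong) (use Suc J_mat_entry[OF _ Suc.prems] in auto)
  also have "\<dots> = (if j = i + Suc k * n then 1 else 0)"
    using Suc.prems by (auto simp: algebra_simps)
  finally show ?case .
qed

text \<open>A shift by \<open>s * n\<close> places leaves the index range.\<close>

lemma J_mat_nilpotent: "J_mat n s ^\<^sub>m s = 0\<^sub>m (n * s) (n * s)"
  by (intro eq_matI) (auto simp: J_mat_pow_entry mult.commute)

section \<open>Well-definedness of \<open>gamma_vec\<close> and \<open>N_mat\<close>\<close>

context
  fixes n s :: nat and b :: "nat \<Rightarrow> complex vec" and X :: "complex mat"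
  assumes s: "s \<ge> 1" and X: "X \<in> carrier_mat (n * s) s"
    and basis: "columns_basis X (krylov s (J_mat n s) (b_bar n s b))"
begin

lemma b_bar_carrier [simp]: "b_bar n s b \<in> carrier_vec (n * s)"
  by (simp add: b_bar_def)

text \<open>\<open>b_bar\<close> is the Krylov vector with exponent 0, present because
  \<open>s \<ge> 1\<close>, hence in the range of \<open>X\<close>. Injectivity of \<open>X\<close>
  gives the uniqueness that \<open>THE\<close> requires.\<close>

lemma gamma_vec_spec: "gamma_vec n s b X \<in> carrier_vec s \<and> b_bar n s b = X *\<^sub>v gamma_vec n s b X"
  unfolding gamma_vec_def
proof (rule theI')
  let ?J = "J_mat n s" and ?b = "b_bar n s b"
  have "?b = krylov_mat s ?J ?b *\<^sub>v unit_vec s 0"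
    using mult_unit_vec_eq_col[of "krylov_mat s ?J ?b" "n * s" s 0] s
      col_krylov_mat[OF J_mat_carrier[of n s] b_bar_carrier, of 0 s] J_mat_carrier[of n s]
    by simp
  then have "?b \<in> krylov s ?J ?b"
    unfolding krylov_range[OF J_mat_carrier b_bar_carrier] by auto
  then obtain g where "g \<in> carrier_vec s" "?b = X *\<^sub>v g"
    unfolding columns_basis_range[OF X basis] by blast
  then show "\<exists>!g. g \<in> carrier_vec s \<and> ?b = X *\<^sub>v g"
    using columns_basis_inj[OF X basis] by (intro ex1I[of _ g]) auto
qed

text \<open>With \<open>G\<close> the matrix of Krylov vectors, \<open>G = X Z\<close>, \<open>X = G Y\<close> and \<open>J G = G S\<close>, so
  \<open>J X = X (Z S Y)\<close>.\<close>

lemma N_mat_spec: "N_mat n s X \<in> carrier_mat s s \<and> J_mat n s * X = X * N_mat n s X"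
  unfolding N_mat_def
proof (rule theI')
  let ?J = "J_mat n s" and ?b = "b_bar n s b"
  let ?G = "krylov_mat s ?J ?b"
  note J = J_mat_carrier[of n s]
  have G: "?G \<in> carrier_mat (n * s) s" using J by simp
  \<comment> \<open>Equal ranges let each of \<open>?G\<close> and \<open>X\<close> be factored
    through the other.\<close>
  have range: "{?G *\<^sub>v x | x. x \<in> carrier_vec s} = {X *\<^sub>v x | x. x \<in> carrier_vec s}"
    using krylov_range[OF J b_bar_carrier] columns_basis_range[OF X basis] by simp
  have colmem: "col M j \<in> {M *\<^sub>v x | x. x \<in> carrier_vec s}"
    if "M \<in> carrier_mat (n * s) s" "j < s" for M :: "complex mat" and j
    using mult_unit_vec_eq_col[OF that] by (metis (mono_tags, lifting) mem_Collect_eq unit_vec_carrier)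
  obtain Z where Z: "Z \<in> carrier_mat s s" "?G = X * Z"
    by (rule mat_factor[OF X G]) (use colmem[OF G] range in blast)+
  obtain Y where Y: "Y \<in> carrier_mat s s" "X = ?G * Y"
    by (rule mat_factor[OF G X]) (use colmem[OF X] range in blast)+
  have "(?J ^\<^sub>m s) *\<^sub>v ?b = 0\<^sub>v (n * s)"
    unfolding J_mat_nilpotent by (rule zero_mat_mult_vec[OF b_bar_carrier])
  then obtain S where S: "S \<in> carrier_mat s s" "?J * ?G = ?G * S"
    by (rule krylov_mat_shift[OF J b_bar_carrier])
  have "?J * X = ?J * (?G * Y)" using Y(2) by simp
  also have "\<dots> = (?J * ?G) * Y" using J G Y(1) by (rule assoc_mult_mat[symmetric])
  also have "\<dots> = ?G * (S * Y)" unfolding S(2) using G S(1) Y(1) by (rule assoc_mult_mat)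
  also have "\<dots> = X * (Z * (S * Y))" unfolding Z(2)
    by (rule assoc_mult_mat[OF X Z(1) mult_carrier_mat[OF S(1) Y(1)]])
  finally have "?J * X = X * (Z * (S * Y))" .
  moreover have "Z * (S * Y) \<in> carrier_mat s s" using Z S Y by simp
  ultimately show "\<exists>!N. N \<in> carrier_mat s s \<and> ?J * X = X * N"
    using columns_basis_inj_mat[OF X basis] by (intro ex1I[of _ "Z * (S * Y)"]) auto
qed

end


section \<open>The error bound\<close>

lemma field_of_values_nonempty:
  assumes "0 < dim_row M"
  shows "field_of_values M \<noteq> {}"
proof -
  have "unit_vec (dim_row M) 0 \<noteq> (0\<^sub>v (dim_row M) :: complex vec)"
    using assms by simp
  then have "(M *\<^sub>v unit_vec (dim_row M) 0) \<bullet>c unit_vec (dim_row M) 0 /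
      (unit_vec (dim_row M) 0 \<bullet>c unit_vec (dim_row M) 0) \<in> field_of_values M"
    unfolding field_of_values_def by (intro CollectI exI conjI refl) auto
  then show ?thesis by auto
qed

text \<open>Test the Crouzeix--Palencia inequality on the constant function 1.\<close>

lemma crouzeix_palencia_constant_nonneg:
  assumes "crouzeix_palencia_constant C"
  shows "0 \<le> C"
proof -
  let ?M = "0\<^sub>m 1 1 :: complex mat" and ?c = "\<lambda>k::nat. if k = 0 then 1 else 0 :: complex"
  have "(\<lambda>k. ?c k * z ^ k) sums 1" for z :: complex
    using sums_single[of 0 "\<lambda>k. z ^ k"] by (simp add: if_distrib[of "\<lambda>x. x * _"] cong: if_cong)
  \<comment> \<open>The series form exposes the dimension of the matrix, which the choice in
    \<open>mat_fun\<close> hides.\<close>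
  then have fun_eq: "mat_fun (\<lambda>_. 1) ?M = mat_series ?c ?M"
    by (intro mat_fun_eq_mat_series) auto
  have "0 \<le> norm2_mat (mat_fun (\<lambda>_. 1) ?M)"
    unfolding fun_eq by (intro norm2_mat_nonneg) simp
  also have "\<dots> \<le> C * (SUP \<zeta>\<in>field_of_values ?M. cmod 1)"
  proof -
    have "?M \<in> carrier_mat 1 1" "(\<lambda>_. 1) analytic_on field_of_values ?M"
      by (auto simp: analytic_on_const)
    then show ?thesis using assms unfolding crouzeix_palencia_constant_def by blast
  qed
  also have "(SUP \<zeta>\<in>field_of_values ?M. cmod 1) = 1"
    using field_of_values_nonempty[of ?M] by simp
  finally show ?thesis by simp
qed

lemma Pi_mat_mult_vec:
  assumes "v \<in> carrier_vec (n + t)"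
  shows "Pi_mat n t *\<^sub>v v = vec n (\<lambda>i. v $ i)"
proof (rule eq_vecI)
  fix i assume "i < dim_vec (vec n (\<lambda>i. v $ i))"
  then have i: "i < n" by simp
  have "(Pi_mat n t *\<^sub>v v) $ i = (\<Sum>j<n+t. (if i = j then 1 else 0) * v $ j)"
    using assms i by (simp add: Pi_mat_def scalar_prod_def lessThan_atLeast0)
  also have "\<dots> = (\<Sum>j<n+t. if j = i then v $ j else 0)" by (intro sum.cong) auto
  finally show "(Pi_mat n t *\<^sub>v v) $ i = vec n (\<lambda>i. v $ i) $ i" using i by simp
qed (simp add: Pi_mat_def)

text \<open>Truncation only drops nonnegative squares.\<close>

lemma norm2_vec_Pi_mat_le:
  assumes "v \<in> carrier_vec (n + t)"
  shows "norm2_vec (Pi_mat n t *\<^sub>v v) \<le> norm2_vec v"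
  using assms unfolding Pi_mat_mult_vec[OF assms] norm2_vec_def
  by (auto intro!: sum_mono2)

section \<open>Transfer from \<open>K_mat\<close> to \<open>W_mat\<close>\<close>

definition embed_mat :: "nat \<Rightarrow> nat \<Rightarrow> complex mat \<Rightarrow> complex mat" where
  "embed_mat n s X = four_block_mat (1\<^sub>m n) (0\<^sub>m n s) (0\<^sub>m (n * s) n) X"

lemma embed_mat_carrier [simp]:
  "X \<in> carrier_mat (n * s) s \<Longrightarrow> embed_mat n s X \<in> carrier_mat (n + n * s) (n + s)"
  by (simp add: embed_mat_def)

lemma embed_mat_mult_append:
  assumes "X \<in> carrier_mat (n * s) s" "u \<in> carrier_vec n" "v \<in> carrier_vec s"
  shows "embed_mat n s X *\<^sub>v (u @\<^sub>v v) = u @\<^sub>v X *\<^sub>v v"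
  unfolding embed_mat_def
  using four_block_mat_mult_vec[OF one_carrier_mat zero_carrier_mat zero_carrier_mat assms] assms
  by (simp add: zero_mat_mult_vec)

lemma Pi_mat_embed_mat:
  assumes X: "X \<in> carrier_mat (n * s) s" and v: "v \<in> carrier_vec (n + s)"
  shows "Pi_mat n (n * s) *\<^sub>v (embed_mat n s X *\<^sub>v v) = Pi_mat n s *\<^sub>v v"
proof -
  have eq: "vec_first v n @\<^sub>v vec_last v s = v" using v by simp
  have "embed_mat n s X *\<^sub>v v = vec_first v n @\<^sub>v X *\<^sub>v vec_last v s"
    using embed_mat_mult_append[OF X, of "vec_first v n" "vec_last v s"] eq by simp
  moreover have "vec_first v n @\<^sub>v X *\<^sub>v vec_last v s \<in> carrier_vec (n + n * s)"
    using X by (intro append_carrier_vec) (auto intro: mult_mat_vec_carrier)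
  ultimately show ?thesis using v X
    by (intro eq_vecI) (simp_all add: Pi_mat_mult_vec vec_first_def)
qed

theorem theorem5p3:
  fixes n s m :: nat and C_cr :: real
    and A X :: "complex mat" and b :: "nat \<Rightarrow> complex vec"
  assumes "crouzeix_palencia_constant C_cr"
    and "n \<ge> 1" and "s \<ge> 1"
    and "A \<in> carrier_mat n n"
    and "\<And>i. i \<le> s \<Longrightarrow> b i \<in> carrier_vec n" and "b s \<noteq> 0\<^sub>v n"
    and "X \<in> carrier_mat (n * s) s"
    and "columns_basis X (krylov s (J_mat n s) (b_bar n s b))"
    and "m \<ge> 1"
  shows "(INF p\<in>{p :: complex poly. degree p \<le> m - 1}.
            norm2_vec (Pi_mat n s *\<^sub>v
              ((mat_exp (K_mat n s A X) - mat_poly p (K_mat n s A X)) *\<^sub>v c_vec n s b X)))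
         \<le> C_cr * norm2_vec (b_full n s b) * best_approx (m - 1) exp (field_of_values (W_mat n s A))"
proof -
  note A = assms(4) and X = assms(7)
  let ?W = "W_mat n s A" and ?K = "K_mat n s A X" and ?V = "embed_mat n s X"
  let ?c = "c_vec n s b X" and ?b = "b_full n s b" and ?J = "J_mat n s" and ?N = "N_mat n s X"
  let ?err = "\<lambda>p. norm2_vec (Pi_mat n s *\<^sub>v ((mat_exp ?K - mat_poly p ?K) *\<^sub>v ?c))"
  note N = N_mat_spec[OF assms(3,7,8)] and g = gamma_vec_spec[OF assms(3,7,8)]
  have E: "E_mat n s \<in> carrier_mat n (n * s)" by (simp add: E_mat_def)
  have b0: "b 0 \<in> carrier_vec n" using assms(5) by simp
  have W: "?W \<in> carrier_mat (n + n * s) (n + n * s)"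
    using A by (simp add: W_mat_def)
  have K: "?K \<in> carrier_mat (n + s) (n + s)"
    using A N by (simp add: K_mat_def)
  have V: "?V \<in> carrier_mat (n + n * s) (n + s)" using X by simp
  have c: "?c \<in> carrier_vec (n + s)" using b0 g by (simp add: c_vec_def)
  have b: "?b \<in> carrier_vec (n + n * s)" using b0 by (simp add: b_full_def b_bar_def)
  have EX: "E_mat n s * X \<in> carrier_mat n s" using E X by simp
  have JX: "?J * X \<in> carrier_mat (n * s) s" using mult_carrier_mat[OF J_mat_carrier X] .
  \<comment> \<open>The two block products differ only in the lower right corner, \<open>J X\<close>
    against \<open>X N\<close>, and these agree by the definition of \<open>N\<close>.\<close>
  have "?W * ?V = four_block_mat A (E_mat n s * X) (0\<^sub>m (n * s) n) (?J * X)"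
    unfolding W_mat_def embed_mat_def
    by (subst mult_four_block_mat[OF A E zero_carrier_mat J_mat_carrier one_carrier_mat zero_carrier_mat zero_carrier_mat X])
      (use A E X EX JX J_mat_carrier[of n s] in \<open>simp add: right_add_zero_mat[OF A] left_add_zero_mat[OF EX] left_add_zero_mat[OF JX]\<close>)
  moreover have "?V * ?K = four_block_mat A (E_mat n s * X) (0\<^sub>m (n * s) n) (X * ?N)"
    unfolding K_mat_def embed_mat_def
    by (subst mult_four_block_mat[OF one_carrier_mat zero_carrier_mat zero_carrier_mat X A EX zero_carrier_mat conjunct1[OF N]])
      (use A X EX N in \<open>simp add: left_mult_one_mat[OF EX] left_mult_zero_mat[OF EX] left_mult_zero_mat[OF conjunct1[OF N]] right_add_zero_mat[OF A] right_add_zero_mat[OF EX] left_add_zero_mat[OF mult_carrier_mat[OF X conjunct1[OF N]]]\<close>)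
  ultimately have WV: "?W * ?V = ?V * ?K" using N by simp
  have Vc: "?V *\<^sub>v ?c = ?b"
    unfolding c_vec_def b_full_def using embed_mat_mult_append[OF X b0 conjunct1[OF g]] g by simp
  have C: "0 \<le> C_cr" by (rule crouzeix_palencia_constant_nonneg[OF assms(1)])
  \<comment> \<open>The bound is first shown for each polynomial separately; the two infima are
    compared only afterwards.\<close>
  have err: "?err p \<le> C_cr * norm2_vec ?b * (SUP \<zeta>\<in>field_of_values ?W. cmod (exp \<zeta> - poly p \<zeta>))" for p
  proof -
    let ?a = "\<lambda>k. 1 / fact k - coeff p k"
    let ?f = "\<lambda>z. exp z - poly p z"
    have K': "mat_series ?a ?K \<in> carrier_mat (n + s) (n + s)" using K by simp
    have W': "mat_series ?a ?W \<in> carrier_mat (n + n * s) (n + n * s)" using W by simp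
    have "Pi_mat n s *\<^sub>v ((mat_exp ?K - mat_poly p ?K) *\<^sub>v ?c) = Pi_mat n s *\<^sub>v (mat_series ?a ?K *\<^sub>v ?c)"
      by (simp add: mat_exp_minus_mat_poly[OF K])
    also have "\<dots> = Pi_mat n (n * s) *\<^sub>v (?V *\<^sub>v (mat_series ?a ?K *\<^sub>v ?c))"
      using Pi_mat_embed_mat[OF X mult_mat_vec_carrier[OF K' c]] by simp
    also have "?V *\<^sub>v (mat_series ?a ?K *\<^sub>v ?c) = (?V * mat_series ?a ?K) *\<^sub>v ?c"
      by (rule assoc_mult_mat_vec[OF V K' c, symmetric])
    also have "\<dots> = (mat_series ?a ?W * ?V) *\<^sub>v ?c"
      using mat_series_intertwine[OF sums_summable[OF sums_exp_minus_poly] K W V WV] by simp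
    also have "\<dots> = mat_series ?a ?W *\<^sub>v ?b"
      using assoc_mult_mat_vec[OF W' V c] Vc by simp
    also have "mat_series ?a ?W = mat_fun ?f ?W"
      by (rule mat_fun_eq_mat_series[OF W sums_exp_minus_poly, symmetric])
    finally have "?err p = norm2_vec (Pi_mat n (n * s) *\<^sub>v (mat_fun ?f ?W *\<^sub>v ?b))" by simp
    also have fW: "mat_fun ?f ?W \<in> carrier_mat (n + n * s) (n + n * s)"
      using W' mat_fun_eq_mat_series[OF W sums_exp_minus_poly] by simp
    have "norm2_vec (Pi_mat n (n * s) *\<^sub>v (mat_fun ?f ?W *\<^sub>v ?b)) \<le> norm2_vec (mat_fun ?f ?W *\<^sub>v ?b)"
      by (rule norm2_vec_Pi_mat_le[OF mult_mat_vec_carrier[OF fW b]])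
    also have "\<dots> \<le> norm2_mat (mat_fun ?f ?W) * norm2_vec ?b"
      by (rule norm2_mult_mat_vec_le) (use b fW in simp)
    also have "norm2_mat (mat_fun ?f ?W) \<le> C_cr * (SUP \<zeta>\<in>field_of_values ?W. cmod (?f \<zeta>))"
    proof -
      \<comment> \<open>\<open>?f\<close> is entire, so it is analytic on any set.\<close>
      have "?f analytic_on field_of_values ?W"
        unfolding poly_altdef by (intro analytic_intros)
      moreover have "1 \<le> n + n * s" using assms(2) by simp
      ultimately show ?thesis
        using assms(1) W unfolding crouzeix_palencia_constant_def by blast
    qed
    finally show ?thesis by (simp add: mult_right_mono mult_ac)
  qed
  have "bdd_below (?err ` {p. degree p \<le> m - 1})" by (rule bdd_belowI2[of _ 0]) simp
  then have inf: "(INF p\<in>{p. degree p \<le> m - 1}. ?err p)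
      \<le> C_cr * norm2_vec ?b * (SUP \<zeta>\<in>field_of_values ?W. cmod (exp \<zeta> - poly p \<zeta>))"
    if "degree p \<le> m - 1" for p
    using cINF_lower[of ?err _ p] err[of p] that by fastforce
  have ne: "{p :: complex poly. degree p \<le> m - 1} \<noteq> {}" by (auto intro: exI[of _ 0])
  show ?thesis
  \<comment> \<open>The infimum on the right is reached by dividing by the constant, which must then
    be positive. If it is zero, the bound for the polynomial 0 already makes the left side at most
    0.\<close>
  proof (cases "C_cr * norm2_vec ?b = 0")
    case True
    have "degree (0 :: complex poly) \<le> m - 1" by simp
    from inf[OF this] show ?thesis by (simp only: True mult_zero_left)
  next
    case False
    then have pos: "0 < C_cr * norm2_vec ?b" using C by (simp add: less_le)
    have "(INF p\<in>{p. degree p \<le> m - 1}. ?err p) / (C_cr * norm2_vec ?b)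
        \<le> best_approx (m - 1) exp (field_of_values ?W)"
      unfolding best_approx_def
      by (rule cINF_greatest[OF ne]) (use inf pos in \<open>simp add: pos_divide_le_eq mult.commute\<close>)
    then show ?thesis using pos by (simp add: pos_divide_le_eq mult.commute)
  qed
qed

end
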